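(* Consider the saddle-point problem $\min_{\theta\in\mathbb{R}}\max_{\phi\in\mathbb{R}}\theta\phi$, whose associated vector field is $V(\theta,\phi)=(\phi,-\theta)$ and whose unique solution is $(0,0)$. Suppose that the stochastic extragradient algorithm, with arbitrary stepsizes $\gamma_t>0$, $$X_{t+1/2}=X_t-\gamma_t\hat V_t,\qquad X_{t+1}=X_t-\gamma_t\hat V_{t+1/2},\qquad t=1,2,\dots,$$ is run on this problem with $X_t=(\theta_t,\phi_t)\in\mathbb{R}^2$ and oracle feedback $\hat V_t=V(\theta_t,\phi_t)+(\xi_t,0)$ for $t\in\{1,3/2,2,\dots\}$, where $\xi_t$ is a zero-mean random variable with variance $\sigma^2>0$. Then $$\liminf_{t\to\infty}\mathbb{E}[\theta_t^2+\phi_t^2]>0,$$ where the limit is over integers $t$.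
   Context: Indices of the iterates and of the oracle calls range over $t\in\{1,3/2,2,5/2,\dots\}$; integer indices correspond to base states and half-integer indices to leading states. "Zero-mean" is understood conditionally on the history: $\mathbb{E}[\xi_t\mid\mathcal{F}_t]=0$, where $\mathcal{F}_t$ is the $\sigma$-algebra generated by $X_s$ for $s\le t$, $s\in\{1,3/2,2,\dots\}$. The initial point $X_1\in\mathbb{R}^2$ is arbitrary. *)

theory Defs
  imports "HOL-Probability.Probability"
begin

definition objective :: "real \<Rightarrow> real \<Rightarrow> real" where
  "objective \<theta> \<phi> = \<theta> * \<phi>"

definition saddle_point :: "(real \<Rightarrow> real \<Rightarrow> real) \<Rightarrow> real \<times> real \<Rightarrow> bool" where
  "saddle_point L = (\<lambda>(\<theta>, \<phi>). \<forall>\<theta>' \<phi>'. L \<theta> \<phi>' \<le> L \<theta> \<phi> \<and> L \<theta> \<phi> \<le> L \<theta>' \<phi>)"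

definition saddle_field :: "(real \<Rightarrow> real \<Rightarrow> real) \<Rightarrow> real \<times> real \<Rightarrow> real \<times> real" where
  "saddle_field L = (\<lambda>(\<theta>, \<phi>). (deriv (\<lambda>x. L x \<phi>) \<theta>, - deriv (\<lambda>y. L \<theta> y) \<phi>))"

definition V :: "real \<times> real \<Rightarrow> real \<times> real" where
  "V = (\<lambda>(\<theta>, \<phi>). (\<phi>, - \<theta>))"

lemma saddle_field_objective: "saddle_field objective = V"
proof
  fix z :: "real \<times> real"
  obtain \<theta> \<phi> where z: "z = (\<theta>, \<phi>)" by (cases z)
  have "((\<lambda>x. x * \<phi>) has_field_derivative \<phi>) (at \<theta>)"
    and "((\<lambda>y. \<theta> * y) has_field_derivative \<theta>) (at \<phi>)"
    by (auto intro!: derivative_eq_intros)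
  then show "saddle_field objective z = V z"
    by (simp add: z saddle_field_def objective_def V_def DERIV_imp_deriv)
qed

lemma saddle_point_objective_iff: "saddle_point objective z \<longleftrightarrow> z = (0, 0)"
proof
  assume s: "saddle_point objective z"
  obtain \<theta> \<phi> where z: "z = (\<theta>, \<phi>)" by (cases z)
  have "\<theta> * (\<phi> + \<theta>) \<le> \<theta> * \<phi>" "\<theta> * \<phi> \<le> (\<theta> - \<phi>) * \<phi>"
    using s unfolding saddle_point_def objective_def z by blast+
  then have "\<theta> * \<theta> \<le> 0" "\<phi> * \<phi> \<le> 0"
    by (simp_all add: algebra_simps)
  then show "z = (0, 0)"
    by (auto simp: z mult_le_0_iff)
qed (simp add: saddle_point_def objective_def)

text \<open>The index set \<open>{1, 3/2, 2, 5/2, \<dots>}\<close>. Processes are total functions of a real index;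
  their values outside this set are irrelevant.\<close>

definition half_steps :: "real set" where
  "half_steps = {1 + real k / 2 | k :: nat. True}"

definition history ::
  "'a measure \<Rightarrow> (real \<Rightarrow> 'a \<Rightarrow> real \<times> real) \<Rightarrow> real \<Rightarrow> 'a measure" where
  "history M X t =
     sigma (space M) {X s -` A \<inter> space M | s A. s \<in> half_steps \<and> s \<le> t \<and> A \<in> sets borel}"

end

theory Submission
  imports Defs
begin

text \<open>
  The expected squared distance to the solution obeys an exact scalar recursion, and this recursion
  cannot approach zero whatever the stepsizes are. Eliminating the leading state expresses
  \<open>X\<^bsub>t+1\<^esub>\<close> as a linear image of \<open>X\<^sub>t\<close> minus \<open>(\<gamma> \<xi>\<^bsub>t+1/2\<^esub>, \<gamma>\<^sup>2 \<xi>\<^sub>t)\<close>. The linear map is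
  \<open>sqrt (1 - \<gamma>\<^sup>2 + \<gamma>\<^sup>4)\<close> times a rotation. The two noise terms enter different coordinates, so their
  product never appears in the squared norm, and each of them is orthogonal in \<open>L\<^sup>2\<close> to the base
  state \<open>X\<^sub>t\<close>, which belongs to both histories. Writing \<open>e\<close> for the expectation of the squared norm
  and \<open>g = \<gamma>\<^sup>2\<close>, this gives (\<open>extragradient_energy\<close>)

  \<open>e' = (1 - g + g\<^sup>2) e + (g + g\<^sup>2) \<sigma>\<^sup>2\<close>.

  The contraction takes away \<open>g (1 - g) e\<close> and the noise brings in at least \<open>g (1 - g) \<sigma>\<^sup>2\<close>, so
  \<open>e' \<ge> min e \<sigma>\<^sup>2\<close> (\<open>energy_map_ge_min\<close>): below the level \<open>\<sigma>\<^sup>2\<close> the energy never decreases. The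
  initial energy may vanish, but the first step makes it positive since \<open>\<sigma>\<^sup>2\<close> and \<open>\<gamma>\<close> are, and from
  then on it stays above the smaller of \<open>\<sigma>\<^sup>2\<close> and its value at time 2.
\<close>

section \<open>Square-integrable random variables\<close>

definition square_integrable :: "'a measure \<Rightarrow> ('a \<Rightarrow> real) \<Rightarrow> bool" where
  "square_integrable M f \<longleftrightarrow> f \<in> borel_measurable M \<and> integrable M (\<lambda>\<omega>. (f \<omega>)\<^sup>2)"

lemma square_integrable_mult_integrable:
  assumes "square_integrable M f" "square_integrable M g"
  shows "integrable M (\<lambda>\<omega>. f \<omega> * g \<omega>)"
proof (rule Bochner_Integration.integrable_bound)
  show "integrable M (\<lambda>\<omega>. (f \<omega>)\<^sup>2 + (g \<omega>)\<^sup>2)"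
    using assms by (simp add: square_integrable_def)
  show "(\<lambda>\<omega>. f \<omega> * g \<omega>) \<in> borel_measurable M"
    using assms by (auto simp: square_integrable_def)
  have "\<bar>a * b\<bar> \<le> a\<^sup>2 + b\<^sup>2" for a b :: real
  proof -
    have "2 * \<bar>a * b\<bar> \<le> a\<^sup>2 + b\<^sup>2"
      using sum_squares_bound[of "\<bar>a\<bar>" "\<bar>b\<bar>"] by (simp add: abs_mult)
    then show ?thesis
      using abs_ge_zero[of "a * b"] by linarith
  qed
  then show "AE \<omega> in M. norm (f \<omega> * g \<omega>) \<le> norm ((f \<omega>)\<^sup>2 + (g \<omega>)\<^sup>2)"
    by (simp del: abs_mult)
qed

lemma square_integrable_linear_combination:
  assumes f: "square_integrable M f" and g: "square_integrable M g"
  shows "square_integrable M (\<lambda>\<omega>. c * f \<omega> + d * g \<omega>)"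
proof -
  have "integrable M (\<lambda>\<omega>. c\<^sup>2 * (f \<omega>)\<^sup>2 + d\<^sup>2 * (g \<omega>)\<^sup>2 + 2 * c * d * (f \<omega> * g \<omega>))"
    using f g square_integrable_mult_integrable[OF f g] by (simp add: square_integrable_def)
  moreover have "c\<^sup>2 * x\<^sup>2 + d\<^sup>2 * y\<^sup>2 + 2 * c * d * (x * y) = (c * x + d * y)\<^sup>2" for x y
    by (simp add: power2_eq_square algebra_simps)
  moreover have "(\<lambda>\<omega>. c * f \<omega> + d * g \<omega>) \<in> borel_measurable M"
    using f g by (auto simp: square_integrable_def)
  ultimately show ?thesis
    by (simp add: square_integrable_def)
qed

lemma square_integrable_cong:
  assumes "\<And>\<omega>. \<omega> \<in> space M \<Longrightarrow> f \<omega> = g \<omega>"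
  shows "square_integrable M f \<longleftrightarrow> square_integrable M g"
  using assms
  by (auto simp: square_integrable_def cong: measurable_cong Bochner_Integration.integrable_cong)

section \<open>Conditionally centred noise\<close>

context prob_space
begin

lemma subalgebra_sigma_finite:
  assumes "subalgebra M F"
  shows "sigma_finite_subalgebra M F"
  by (rule finite_measure_subalgebra_is_sigma_finite)
    (simp add: finite_measure_subalgebra_def finite_measure_subalgebra_axioms_def assms
      finite_measure_axioms)

text \<open>An \<open>F\<close>-measurable factor can be moved past the conditional expectation, which vanishes. This is
  what removes the mixed terms from the energy.\<close>

lemma conditionally_centred_orthogonal:
  assumes F: "subalgebra M F" and f: "f \<in> borel_measurable F" "square_integrable M f"
    and z: "square_integrable M z" "AE \<omega> in M. real_cond_exp M F z \<omega> = 0"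
  shows "expectation (\<lambda>\<omega>. f \<omega> * z \<omega>) = 0"
proof -
  interpret sigma_finite_subalgebra M F
    by (rule subalgebra_sigma_finite[OF F])
  have "expectation (\<lambda>\<omega>. f \<omega> * z \<omega>) = expectation (\<lambda>\<omega>. f \<omega> * real_cond_exp M F z \<omega>)"
    using real_cond_exp_intg(2)[OF square_integrable_mult_integrable[OF f(2) z(1)] f(1)] z(1)
    by (simp add: square_integrable_def)
  also have "\<dots> = 0"
    using z(2) by (intro integral_eq_zero_AE) auto
  finally show ?thesis .
qed

lemma square_integrable_const: "square_integrable M (\<lambda>_. c)"
  by (simp add: square_integrable_def)

lemma conditionally_centred_second_moment:
  assumes F: "subalgebra M F"
    and z: "square_integrable M z" "AE \<omega> in M. real_cond_exp M F z \<omega> = 0"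
  shows "expectation (\<lambda>\<omega>. (z \<omega>)\<^sup>2) = variance z"
proof -
  have "expectation z = 0"
    using conditionally_centred_orthogonal[OF F _ square_integrable_const z, of 1] by simp
  then show ?thesis by simp
qed

end

section \<open>The history of a process\<close>

lemma subalgebra_history:
  assumes "\<And>s. s \<in> half_steps \<Longrightarrow> X s \<in> borel_measurable M"
  shows "subalgebra M (history M X t)"
proof -
  let ?G = "{X s -` A \<inter> space M | s A. s \<in> half_steps \<and> s \<le> t \<and> A \<in> sets borel}"
  have "?G \<subseteq> sets M"
    by (auto intro: measurable_sets[OF assms])
  moreover have "?G \<subseteq> Pow (space M)"
    by auto
  ultimately show ?thesis
    unfolding subalgebra_def history_def
    by (simp add: space_measure_of sets_measure_of sets.sigma_sets_subset)
qed

lemma measurable_history: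
  assumes "s \<in> half_steps" "s \<le> t"
  shows "X s \<in> borel_measurable (history M X t)"
proof (rule measurableI)
  fix A :: "(real \<times> real) set" assume "A \<in> sets borel"
  moreover have "{X s -` A \<inter> space M | s A. s \<in> half_steps \<and> s \<le> t \<and> A \<in> sets borel} \<subseteq> Pow (space M)"
    by auto
  ultimately show "X s -` A \<inter> space (history M X t) \<in> sets (history M X t)"
    unfolding history_def using assms
    by (auto simp: space_measure_of sets_measure_of intro!: sigma_sets.Basic)
qed simp

section \<open>One extragradient step\<close>

text \<open>Eliminating the leading state. The noise \<open>x\<close> of the first oracle call sits in the first
  coordinate of the leading state, and the field swaps coordinates; hence the two noises end up in
  different coordinates of the new base state.\<close>

lemma extragradient_step:
  fixes z :: "real \<times> real"
  assumes "half = z - c *\<^sub>R (V z + (x, 0))" "next_base = z - c *\<^sub>R (V half + (y, 0))"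
  shows "next_base = ((1 - c\<^sup>2) * fst z - c * snd z - c * y, (1 - c\<^sup>2) * snd z + c * fst z - c\<^sup>2 * x)"
  using assms by (cases z) (simp add: V_def power2_eq_square algebra_simps)

text \<open>Expanding the squared norm, the mixed products of \<open>a\<close> and \<open>b\<close> cancel because the linear part is
  a multiple of a rotation, and \<open>x y\<close> never appears because the noises are in different coordinates.
  What remains of the mixed terms pairs a base coordinate with a noise. In particular \<open>x\<close> and \<open>y\<close>
  may be arbitrarily correlated.\<close>

lemma (in prob_space) extragradient_energy:
  fixes a b x y :: "'a \<Rightarrow> real" and c v :: real
  defines "a' \<equiv> \<lambda>\<omega>. (1 - c\<^sup>2) * a \<omega> - c * b \<omega> - c * y \<omega>"
    and "b' \<equiv> \<lambda>\<omega>. (1 - c\<^sup>2) * b \<omega> + c * a \<omega> - c\<^sup>2 * x \<omega>"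
  assumes sq: "square_integrable M a" "square_integrable M b"
      "square_integrable M x" "square_integrable M y"
    and orth: "expectation (\<lambda>\<omega>. a \<omega> * x \<omega>) = 0" "expectation (\<lambda>\<omega>. b \<omega> * x \<omega>) = 0"
      "expectation (\<lambda>\<omega>. a \<omega> * y \<omega>) = 0" "expectation (\<lambda>\<omega>. b \<omega> * y \<omega>) = 0"
    and var: "expectation (\<lambda>\<omega>. (x \<omega>)\<^sup>2) = v" "expectation (\<lambda>\<omega>. (y \<omega>)\<^sup>2) = v"
  shows "expectation (\<lambda>\<omega>. (a' \<omega>)\<^sup>2 + (b' \<omega>)\<^sup>2) =
    (1 - c\<^sup>2 + (c\<^sup>2)\<^sup>2) * expectation (\<lambda>\<omega>. (a \<omega>)\<^sup>2 + (b \<omega>)\<^sup>2) + (c\<^sup>2 + (c\<^sup>2)\<^sup>2) * v"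
proof -
  have expand: "(a' \<omega>)\<^sup>2 + (b' \<omega>)\<^sup>2 =
      (1 - c\<^sup>2 + (c\<^sup>2)\<^sup>2) * ((a \<omega>)\<^sup>2 + (b \<omega>)\<^sup>2) + c\<^sup>2 * (y \<omega>)\<^sup>2 + (c\<^sup>2)\<^sup>2 * (x \<omega>)\<^sup>2
      - (2 * c * (1 - c\<^sup>2)) * (a \<omega> * y \<omega>) + (2 * c\<^sup>2) * (b \<omega> * y \<omega>)
      - (2 * c\<^sup>2 * (1 - c\<^sup>2)) * (b \<omega> * x \<omega>) - (2 * c\<^sup>2 * c) * (a \<omega> * x \<omega>)" for \<omega>
    unfolding a'_def b'_def by (simp add: power2_eq_square algebra_simps)
  have int: "integrable M (\<lambda>\<omega>. a \<omega> * x \<omega>)" "integrable M (\<lambda>\<omega>. b \<omega> * x \<omega>)"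
      "integrable M (\<lambda>\<omega>. a \<omega> * y \<omega>)" "integrable M (\<lambda>\<omega>. b \<omega> * y \<omega>)"
    by (intro square_integrable_mult_integrable sq)+
  have int2: "integrable M (\<lambda>\<omega>. (a \<omega>)\<^sup>2)" "integrable M (\<lambda>\<omega>. (b \<omega>)\<^sup>2)"
      "integrable M (\<lambda>\<omega>. (x \<omega>)\<^sup>2)" "integrable M (\<lambda>\<omega>. (y \<omega>)\<^sup>2)"
    using sq by (simp_all add: square_integrable_def)
  show ?thesis
    unfolding expand using int int2 orth var by (simp, simp add: algebra_simps)
qed

section \<open>The scalar recursion\<close>

text \<open>Both coefficients are compared with \<open>w = g (1 - g)\<close>. For \<open>w \<ge> 0\<close> the image is at least the
  convex combination \<open>(1 - w) e + w v\<close>; for \<open>w < 0\<close> the linear part alone does not contract.\<close>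

lemma energy_map_ge_min:
  fixes e g v :: real
  assumes "e \<ge> 0" "g \<ge> 0" "v \<ge> 0"
  shows "(1 - g + g\<^sup>2) * e + (g + g\<^sup>2) * v \<ge> min e v"
proof (cases "g \<le> 1")
  case True
  define w where "w = g * (1 - g)"
  have w: "0 \<le> w" "w \<le> 1"
    using assms True mult_mono[of g 1 "1 - g" 1] by (auto simp: w_def)
  have "min e v = (1 - w) * min e v + w * min e v"
    by (simp add: algebra_simps)
  also have "\<dots> \<le> (1 - w) * e + w * v"
    using w by (intro add_mono mult_left_mono) auto
  also have "\<dots> \<le> (1 - w) * e + (g + g\<^sup>2) * v"
    using assms by (intro add_left_mono mult_right_mono) (auto simp: w_def power2_eq_square algebra_simps)
  also have "1 - w = 1 - g + g\<^sup>2"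
    by (simp add: w_def power2_eq_square algebra_simps)
  finally show ?thesis .
next
  case False
  have "e * 1 \<le> e * (1 - g + g\<^sup>2)"
    using assms False mult_left_mono[of 1 g g] by (intro mult_left_mono) (auto simp: power2_eq_square)
  moreover have "0 \<le> (g + g\<^sup>2) * v"
    using assms by simp
  ultimately show ?thesis
    by (simp add: mult.commute min_def)
qed

lemma energy_map_pos:
  fixes e g v :: real
  assumes "e \<ge> 0" "g > 0" "v > 0"
  shows "(1 - g + g\<^sup>2) * e + (g + g\<^sup>2) * v > 0"
proof -
  have "0 < (g + g\<^sup>2) * v"
    using assms by (simp add: add_pos_pos)
  moreover have "1 - g + g\<^sup>2 = (g - 1/2)\<^sup>2 + 3/4"
    by (simp add: power2_eq_square algebra_simps)
  then have "0 \<le> (1 - g + g\<^sup>2) * e"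
    using assms by simp
  ultimately show ?thesis by simp
qed

section \<open>Energy of the iterates\<close>

lemma half_steps_nat: "t \<ge> 1 \<Longrightarrow> real t \<in> half_steps"
  unfolding half_steps_def by (auto intro!: exI[of _ "2 * (t - 1)"] simp: of_nat_diff diff_divide_distrib)

lemma half_steps_half: "t \<ge> 1 \<Longrightarrow> real t + 1/2 \<in> half_steps"
  unfolding half_steps_def by (auto intro!: exI[of _ "2 * (t - 1) + 1"] simp: of_nat_diff field_simps)

lemma half_steps_cases:
  assumes "s \<in> half_steps"
  obtains t :: nat where "t \<ge> 1" "s = real t" | t :: nat where "t \<ge> 1" "s = real t + 1/2"
proof -
  obtain k :: nat where k: "s = 1 + real k / 2"
    using assms by (auto simp: half_steps_def)
  show thesis
  proof (cases "even k")
    case True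
    then show thesis using k that(1)[of "Suc (k div 2)"] by (auto elim!: evenE)
  next
    case False
    then show thesis using k that(2)[of "Suc (k div 2)"] by (auto elim!: oddE simp: field_simps)
  qed
qed

theorem proposition1:
  fixes M :: "'a measure"
    and X Vhat :: "real \<Rightarrow> 'a \<Rightarrow> real \<times> real"
    and \<xi> :: "real \<Rightarrow> 'a \<Rightarrow> real"
    and \<gamma> :: "nat \<Rightarrow> real"
    and x1 :: "real \<times> real"
    and \<sigma> :: real
  assumes "prob_space M"
    and "\<sigma>\<^sup>2 > 0"
    and "\<And>t. t \<ge> 1 \<Longrightarrow> \<gamma> t > 0"
    and "\<And>\<omega>. \<omega> \<in> space M \<Longrightarrow> X 1 \<omega> = x1"
    and "\<And>t \<omega>. t \<ge> 1 \<Longrightarrow> \<omega> \<in> space M \<Longrightarrow>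
           X (real t + 1/2) \<omega> = X (real t) \<omega> - \<gamma> t *\<^sub>R Vhat (real t) \<omega>"
    and "\<And>t \<omega>. t \<ge> 1 \<Longrightarrow> \<omega> \<in> space M \<Longrightarrow>
           X (real t + 1) \<omega> = X (real t) \<omega> - \<gamma> t *\<^sub>R Vhat (real t + 1/2) \<omega>"
    and "\<And>t \<omega>. t \<in> half_steps \<Longrightarrow> \<omega> \<in> space M \<Longrightarrow> Vhat t \<omega> = V (X t \<omega>) + (\<xi> t \<omega>, 0)"
    and "\<And>t. t \<in> half_steps \<Longrightarrow> \<xi> t \<in> borel_measurable M"
    and "\<And>t. t \<in> half_steps \<Longrightarrow> integrable M (\<lambda>\<omega>. (\<xi> t \<omega>)\<^sup>2)"
    and "\<And>t. t \<in> half_steps \<Longrightarrow> AE \<omega> in M. real_cond_exp M (history M X t) (\<xi> t) \<omega> = 0"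
    and "\<And>t. t \<in> half_steps \<Longrightarrow> prob_space.variance M (\<xi> t) = \<sigma>\<^sup>2"
  shows "liminf (\<lambda>t::nat. ereal (prob_space.expectation M
           (\<lambda>\<omega>. (fst (X (real t) \<omega>))\<^sup>2 + (snd (X (real t) \<omega>))\<^sup>2))) > 0"
proof -
  interpret prob_space M by (rule assms(1))
  note half_steps_nat[simp] half_steps_half[simp]
  have noise: "square_integrable M (\<xi> t)" if "t \<in> half_steps" for t
    using assms(8,9) that by (simp add: square_integrable_def)
  have half: "X (real t + 1/2) \<omega> = X (real t) \<omega> - \<gamma> t *\<^sub>R (V (X (real t) \<omega>) + (\<xi> (real t) \<omega>, 0))"
    if "t \<ge> 1" "\<omega> \<in> space M" for t \<omega>
    using assms(5)[OF that] assms(7)[of "real t" \<omega>] that by simp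
  have next_state: "X (real (Suc t)) \<omega> =
      ((1 - (\<gamma> t)\<^sup>2) * fst (X (real t) \<omega>) - \<gamma> t * snd (X (real t) \<omega>) - \<gamma> t * \<xi> (real t + 1/2) \<omega>,
       (1 - (\<gamma> t)\<^sup>2) * snd (X (real t) \<omega>) + \<gamma> t * fst (X (real t) \<omega>) - (\<gamma> t)\<^sup>2 * \<xi> (real t) \<omega>)"
    if "t \<ge> 1" "\<omega> \<in> space M" for t \<omega>
    using assms(6)[OF that] assms(7)[of "real t + 1/2" \<omega>] that
    by (intro extragradient_step[OF half[OF that]]) (simp add: add.commute)

  \<comment> \<open>Measurability of the states comes first: conditional
     expectation given the history is meaningful only once the history is a sub-\<open>\<sigma>\<close>-algebra of \<open>M\<close>.\<close>
  have base: "square_integrable M (\<lambda>\<omega>. fst (X (real t) \<omega>))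
      \<and> square_integrable M (\<lambda>\<omega>. snd (X (real t) \<omega>))" if "t \<ge> 1" for t :: nat
    using that
  proof (induction t rule: dec_induct)
    case base
    have "square_integrable M (\<lambda>\<omega>. fst (X 1 \<omega>)) \<longleftrightarrow> square_integrable M (\<lambda>_. fst x1)"
      "square_integrable M (\<lambda>\<omega>. snd (X 1 \<omega>)) \<longleftrightarrow> square_integrable M (\<lambda>_. snd x1)"
      using assms(4) by (auto intro!: square_integrable_cong)
    then show ?case by (simp add: square_integrable_const)
  next
    case (step t)
    let ?a = "\<lambda>\<omega>. fst (X (real t) \<omega>)" and ?b = "\<lambda>\<omega>. snd (X (real t) \<omega>)"
    have "square_integrable M (\<lambda>\<omega>. 1 * ((1 - (\<gamma> t)\<^sup>2) * ?a \<omega> + (- \<gamma> t) * ?b \<omega>)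
        + (- \<gamma> t) * \<xi> (real t + 1/2) \<omega>)"
      "square_integrable M (\<lambda>\<omega>. 1 * ((1 - (\<gamma> t)\<^sup>2) * ?b \<omega> + \<gamma> t * ?a \<omega>)
        + (- (\<gamma> t)\<^sup>2) * \<xi> (real t) \<omega>)"
      using step noise by (intro square_integrable_linear_combination; simp)+
    then show ?case
      using next_state[OF step(1)]
      by (simp cong: square_integrable_cong)
  qed
  have meas_base: "X (real t) \<in> borel_measurable M" if "t \<ge> 1" for t
    using base[OF that] borel_measurable_Pair[of "\<lambda>\<omega>. fst (X (real t) \<omega>)" M "\<lambda>\<omega>. snd (X (real t) \<omega>)"]
    by (simp add: square_integrable_def)
  have meas: "X s \<in> borel_measurable M" if "s \<in> half_steps" for s
    using that
  proof (cases rule: half_steps_cases)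
    case (1 t)
    then show ?thesis using meas_base by simp
  next
    case (2 t)
    have [measurable]: "X (real t) \<in> borel_measurable M" "\<xi> (real t) \<in> borel_measurable M"
      "(\<lambda>\<omega>. fst (X (real t) \<omega>)) \<in> borel_measurable M" "(\<lambda>\<omega>. snd (X (real t) \<omega>)) \<in> borel_measurable M"
      using 2 meas_base assms(8) base by (simp_all add: square_integrable_def)
    have "(\<lambda>\<omega>. X (real t) \<omega> - \<gamma> t *\<^sub>R (V (X (real t) \<omega>) + (\<xi> (real t) \<omega>, 0))) \<in> borel_measurable M"
      unfolding V_def case_prod_beta
      by (intro borel_measurable_diff borel_measurable_scaleR borel_measurable_add
          borel_measurable_Pair borel_measurable_uminus) measurable
    then show ?thesis
      using 2 half by (simp cong: measurable_cong)
  qed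
  note sub = subalgebra_history[OF meas]

  have second_moment: "expectation (\<lambda>\<omega>. (\<xi> s \<omega>)\<^sup>2) = \<sigma>\<^sup>2" if "s \<in> half_steps" for s
    using conditionally_centred_second_moment[OF sub noise[OF that] assms(10)[OF that]] assms(11)[OF that]
    by simp
  have orth: "expectation (\<lambda>\<omega>. fst (X (real t) \<omega>) * \<xi> s \<omega>) = 0"
    "expectation (\<lambda>\<omega>. snd (X (real t) \<omega>) * \<xi> s \<omega>) = 0"
    if "t \<ge> 1" "s \<in> half_steps" "real t \<le> s" for t s
  proof -
    have X: "X (real t) \<in> borel_measurable (history M X s)"
      using that by (intro measurable_history) auto
    have "(fst :: real \<times> real \<Rightarrow> real) \<in> borel_measurable borel"
      "(snd :: real \<times> real \<Rightarrow> real) \<in> borel_measurable borel"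
      by (intro borel_measurable_continuous_onI continuous_intros)+
    note coords = this[THEN measurable_compose[OF X]]
    show "expectation (\<lambda>\<omega>. fst (X (real t) \<omega>) * \<xi> s \<omega>) = 0"
      "expectation (\<lambda>\<omega>. snd (X (real t) \<omega>) * \<xi> s \<omega>) = 0"
      using base[OF that(1)]
      by (auto intro: conditionally_centred_orthogonal[OF sub coords(1) _ noise[OF that(2)] assms(10)[OF that(2)]]
          conditionally_centred_orthogonal[OF sub coords(2) _ noise[OF that(2)] assms(10)[OF that(2)]])
  qed

  define e where "e t = expectation (\<lambda>\<omega>. (fst (X (real t) \<omega>))\<^sup>2 + (snd (X (real t) \<omega>))\<^sup>2)" for t :: nat
  have e_nonneg: "e t \<ge> 0" for t
    by (simp add: e_def)
  have recursion: "e (Suc t) =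
      (1 - (\<gamma> t)\<^sup>2 + ((\<gamma> t)\<^sup>2)\<^sup>2) * e t + ((\<gamma> t)\<^sup>2 + ((\<gamma> t)\<^sup>2)\<^sup>2) * \<sigma>\<^sup>2" if "t \<ge> 1" for t
  proof -
    have "e (Suc t) = expectation (\<lambda>\<omega>.
        ((1 - (\<gamma> t)\<^sup>2) * fst (X (real t) \<omega>) - \<gamma> t * snd (X (real t) \<omega>) - \<gamma> t * \<xi> (real t + 1/2) \<omega>)\<^sup>2 +
        ((1 - (\<gamma> t)\<^sup>2) * snd (X (real t) \<omega>) + \<gamma> t * fst (X (real t) \<omega>) - (\<gamma> t)\<^sup>2 * \<xi> (real t) \<omega>)\<^sup>2)"
      unfolding e_def by (intro Bochner_Integration.integral_cong refl) (simp add: next_state[OF that] del: of_nat_Suc)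
    also have "\<dots> = (1 - (\<gamma> t)\<^sup>2 + ((\<gamma> t)\<^sup>2)\<^sup>2) * e t + ((\<gamma> t)\<^sup>2 + ((\<gamma> t)\<^sup>2)\<^sup>2) * \<sigma>\<^sup>2"
      unfolding e_def using that base[OF that]
      by (intro extragradient_energy noise orth second_moment) auto
    finally show ?thesis .
  qed

  \<comment> \<open>The bound starts at time 2, since \<open>e 1\<close> is zero when the initial point is the solution.\<close>
  define m where "m = min (e 2) (\<sigma>\<^sup>2)"
  have "e 2 > 0"
    using recursion[of 1] energy_map_pos[OF e_nonneg, of "(\<gamma> 1)\<^sup>2" "\<sigma>\<^sup>2" 1] assms(2) assms(3)[of 1]
    by (simp add: numeral_2_eq_2)
  then have "m > 0"
    using assms(2) by (simp add: m_def)
  have lower: "m \<le> e t" if "t \<ge> 2" for t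
    using that
  proof (induction t rule: dec_induct)
    case base
    show ?case by (simp add: m_def)
  next
    case (step t)
    have "m \<le> min (e t) (\<sigma>\<^sup>2)"
      using step by (simp add: m_def)
    also have "\<dots> \<le> e (Suc t)"
      using recursion[of t] energy_map_ge_min[OF e_nonneg, of "(\<gamma> t)\<^sup>2" "\<sigma>\<^sup>2" t] step by simp
    finally show ?case .
  qed
  have "0 < ereal m"
    using \<open>m > 0\<close> by simp
  also have "\<dots> \<le> liminf (\<lambda>t. ereal (e t))"
    using lower by (intro Liminf_bounded eventually_sequentiallyI[of 2]) simp
  finally show ?thesis
    unfolding e_def .
qed

end
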